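(* Let $x>0$ and let $r_0,s_0,t_0$ be three negative integers such that all of them are odd or exactly one of them is odd. Then $\Theta(r_0,s_0,t,x)$ vanishes as $t\to t_0$, i.e. $\lim_{t\to t_0}\Theta(r_0,s_0,t,x)=0$.
   Context: For $x>0$ and $(r,s,t)\in\mathbb{C}^3$ with $\Re(r+t)>1$, $\Re(s+t)>1$, $\Re(r+s+t)>2$, the generalized Mordell–Tornheim zeta function is the absolutely convergent series $\Theta(r,s,t,x)=\sum_{n=1}^{\infty}\sum_{m=1}^{\infty}\frac{1}{n^r m^s (n+mx)^t}$. For fixed $x>0$ it continues meromorphically to $(r,s,t)\in\mathbb{C}^3$, with singularities only on the hyperplanes $r+t=1-\ell$, $s+t=1-\ell$ ($\ell\in\{0,1,2,\dots\}$) and $r+s+t=2$; $\Theta$ also denotes this continuation. With $r_0,s_0$ fixed, $\Theta(r_0,s_0,t,x)$ is considered as a meromorphic function of the one complex variable $t$. *)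

theory Defs
  imports "HOL-Analysis.Analysis"
begin

(* Holomorphy in three complex variables at every point of U (meant for open U):
   the real Frechet derivative exists and is complex linear. *)
definition holomorphic3_on :: "(complex \<times> complex \<times> complex \<Rightarrow> complex) \<Rightarrow> (complex \<times> complex \<times> complex) set \<Rightarrow> bool"
  where "holomorphic3_on f U \<longleftrightarrow>
    (\<forall>p\<in>U. \<exists>a b c. (f has_derivative (\<lambda>(u, v, w). a * u + b * v + c * w)) (at p))"

(* f is meromorphic on C^3 with singularities only on S: holomorphic off S, and near every
   point a quotient g / h of holomorphic functions whose denominator vanishes identically on
   no nonempty open set.  The values of f on S itself are irrelevant.  The quotient is written
   as f * h = g, because h may vanish at points where f is regular. *)
definition meromorphic3_off :: "(complex \<times> complex \<times> complex \<Rightarrow> complex) \<Rightarrow> (complex \<times> complex \<times> complex) set \<Rightarrow> bool"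
  where "meromorphic3_off f S \<longleftrightarrow>
    holomorphic3_on f (- S) \<and>
    (\<forall>p. \<exists>U g h. open U \<and> p \<in> U \<and> holomorphic3_on g U \<and> holomorphic3_on h U \<and>
       (\<forall>V. open V \<and> V \<noteq> {} \<and> V \<subseteq> U \<longrightarrow> (\<exists>q\<in>V. h q \<noteq> 0)) \<and>
       (\<forall>q\<in>U - S. f q * h q = g q))"

definition mordell_tornheim_series :: "complex \<Rightarrow> complex \<Rightarrow> complex \<Rightarrow> real \<Rightarrow> complex"
  where "mordell_tornheim_series r s t x =
    (\<Sum>\<^sub>\<infinity>n\<in>{1::nat..}. \<Sum>\<^sub>\<infinity>m\<in>{1::nat..}.
       1 / (of_nat n powr r * of_nat m powr s * of_real (real n + real m * x) powr t))"

definition mordell_tornheim_region :: "(complex \<times> complex \<times> complex) set"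
  where "mordell_tornheim_region = {(r, s, t). Re (r + t) > 1 \<and> Re (s + t) > 1 \<and> Re (r + s + t) > 2}"

definition mordell_tornheim_singular :: "(complex \<times> complex \<times> complex) set"
  where "mordell_tornheim_singular =
    {(r, s, t). (\<exists>l::nat. r + t = 1 - of_nat l) \<or> (\<exists>l::nat. s + t = 1 - of_nat l) \<or> r + s + t = 2}"

(* Theta is the generalized Mordell-Tornheim zeta function (r, s, t) \<mapsto> Theta(r, s, t, x) for the
   fixed parameter x, i.e. the meromorphic continuation of the series to C^3.  The complement of
   the singular hyperplanes is connected, so Theta is determined there. *)
definition is_mordell_tornheim_zeta :: "real \<Rightarrow> (complex \<times> complex \<times> complex \<Rightarrow> complex) \<Rightarrow> bool"
  where "is_mordell_tornheim_zeta x \<Theta> \<longleftrightarrow>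
    meromorphic3_off \<Theta> mordell_tornheim_singular \<and>
    (\<forall>(r, s, t)\<in>mordell_tornheim_region. \<Theta> (r, s, t) = mordell_tornheim_series r s t x)"

end

theory Submission
  imports Defs "HOL-Complex_Analysis.Complex_Analysis" "HOL-Real_Asymp.Real_Asymp"
begin

text \<open>Write \<open>r0 = -a\<close>, \<open>s0 = -b\<close>, \<open>t0 = -c\<close>; the hypothesis implies that \<open>a + b + c\<close> is odd. For
  \<open>Re t\<close> large, \<open>\<Gamma>(t) \<Theta>(-a, -b, t)\<close> is the Mellin transform of \<open>A\<^sub>a(u) A\<^sub>b(x u)\<close> with
  \<open>A\<^sub>k(u) = \<Sum>n. n\<^sup>k exp(-n u)\<close>. As \<open>A\<^sub>1(u) = 1 / (4 sinh\<^sup>2(u/2))\<close> and \<open>A\<^sub>k\<^sub>+\<^sub>1 = - A\<^sub>k'\<close>, the function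
  \<open>u\<^sup>k\<^sup>+\<^sup>1 A\<^sub>k(u)\<close> is even and holomorphic at \<open>0\<close>. Splitting the integral near \<open>0\<close> therefore continues
  the Mellin transform with poles only at integers of the parity of \<open>a + b\<close>. Hence it is regular at
  \<open>-c\<close>, and the zero of \<open>1/\<Gamma>\<close> there forces \<open>\<Theta>\<close> to vanish. Since \<open>(-a, -b, t)\<close> meets the singular
  hyperplanes only for integral \<open>t\<close>, the identity theorem in the single variable \<open>t\<close> suffices.\<close>

section \<open>Even numerators of the exponential sums\<close>

text \<open>Termwise differentiation keeps the unit disc of convergence; following it by
  multiplication by \<open>z\<close> raises the exponent \<open>a\<close> by one.\<close>

lemma summable_power_times_geometric:
  fixes z :: complex
  assumes "norm z < 1"
  shows "summable (\<lambda>n. of_nat n ^ a * z ^ n)"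
  using assms
proof (induction a arbitrary: z)
  case 0
  thus ?case by (simp add: summable_geometric)
next
  case (Suc a)
  let ?c = "\<lambda>n. of_nat n ^ a :: complex"
  have "summable (\<lambda>n. diffs ?c n * z ^ n)"
    using Suc by (intro termdiff_converges[where K = 1]) auto
  hence "summable (\<lambda>n. z * (diffs ?c n * z ^ n))" by (rule summable_mult)
  also have "(\<lambda>n. z * (diffs ?c n * z ^ n)) = (\<lambda>n. of_nat (Suc n) ^ Suc a * z ^ Suc n)"
    by (simp add: fun_eq_iff diffs_def algebra_simps)
  finally show ?case by (subst (asm) summable_Suc_iff)
qed

text \<open>This is the numerator of \<open>A\<^sub>1\<close>. Here
  \<open>exp (w/2) - exp (-(w/2))\<close> has a simple zero at 0, and its other zeros are nonzero
  multiples of \<open>2 * pi * \<i>\<close>, hence outside the unit disc.\<close>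

lemma even_holomorphic_sinh_quotient:
  obtains \<alpha> :: "complex \<Rightarrow> complex"
  where "\<alpha> holomorphic_on ball 0 1" "\<And>w. w \<in> ball 0 1 \<Longrightarrow> \<alpha> (-w) = \<alpha> w"
    "\<And>w. w \<in> ball 0 1 \<Longrightarrow> w \<noteq> 0 \<Longrightarrow> \<alpha> w = (w / (exp (w/2) - exp (-(w/2))))\<^sup>2"
proof -
  define g where "g = (\<lambda>w::complex. exp (w/2) - exp (-(w/2)))"
  \<comment> \<open>Dividing out the zero at 0 leaves a removable singularity, filled by the
    derivative, which is 1 and thus nonzero.\<close>
  define S where "S = (\<lambda>w. if w = 0 then deriv g 0 else g w / w)"
  have g0: "g 0 = 0" by (simp add: g_def)
  have gh: "g holomorphic_on UNIV" unfolding g_def by (intro holomorphic_intros) auto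
  have "(g has_field_derivative 1) (at 0)"
    unfolding g_def by (auto intro!: derivative_eq_intros)
  hence dg: "deriv g 0 = 1" by (rule DERIV_imp_deriv)
  have S: "S holomorphic_on UNIV"
    by (rule pole_theorem_open_0[OF gh]) (auto simp: S_def g0)
  have nz: "S w \<noteq> 0" if "w \<in> ball 0 1" for w
  proof (cases "w = 0")
    case False
    have "g w \<noteq> 0"
    proof
      assume "g w = 0"
      hence "exp (w/2) = exp (-(w/2))" by (simp add: g_def)
      then obtain n :: int where n: "w/2 = -(w/2) + of_int (2 * n) * of_real pi * \<i>"
        unfolding exp_eq by auto
      hence w: "w = of_int (2 * n) * of_real pi * \<i>" by (simp add: algebra_simps)
      hence "n \<noteq> 0" using False by auto
      hence "1 \<le> \<bar>n\<bar>" by linarith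
      hence "1 \<le> \<bar>real_of_int n\<bar>" by linarith
      moreover have "norm w = 2 * \<bar>real_of_int n\<bar> * pi" unfolding w by (simp add: norm_mult)
      ultimately have "norm w \<ge> 2 * 1 * pi" by (simp add: mult_right_mono)
      with that pi_gt3 show False by simp
    qed
    thus ?thesis using False by (simp add: S_def)
  qed (simp add: S_def dg)
  show ?thesis
  proof
    show "(\<lambda>w. 1 / (S w)\<^sup>2) holomorphic_on ball 0 1"
      using S nz by (intro holomorphic_intros holomorphic_on_subset[OF S]) auto
    show "1 / (S (-w))\<^sup>2 = 1 / (S w)\<^sup>2" for w
      by (simp add: S_def g_def power2_commute power_divide)
    show "1 / (S w)\<^sup>2 = (w / (exp (w/2) - exp (-(w/2))))\<^sup>2" if "w \<noteq> 0" for w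
      using that by (simp add: S_def g_def power_divide)
  qed
qed

text \<open>Applying \<open>- d/dw\<close> to \<open>\<alpha> w / w ^ (a + 2)\<close> gives the next numerator
  \<open>(a + 2) * \<alpha> w - w * \<alpha>' w\<close>, which is again even.\<close>

lemma power_times_exp_sums_even_over_power:
  shows "\<exists>\<alpha>. \<alpha> holomorphic_on ball 0 1 \<and> (\<forall>w\<in>ball 0 1. \<alpha> (-w) = \<alpha> w) \<and>
    (\<forall>w\<in>ball 0 1. Re w > 0 \<longrightarrow>
      (\<lambda>n. of_nat n ^ Suc a * exp (- w) ^ n) sums (\<alpha> w / w ^ (a + 2)))"
proof (induction a)
  case 0
  obtain \<alpha> :: "complex \<Rightarrow> complex"
    where \<alpha>: "\<alpha> holomorphic_on ball 0 1" "\<And>w. w \<in> ball 0 1 \<Longrightarrow> \<alpha> (-w) = \<alpha> w"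
      "\<And>w. w \<in> ball 0 1 \<Longrightarrow> w \<noteq> 0 \<Longrightarrow> \<alpha> w = (w / (exp (w/2) - exp (-(w/2))))\<^sup>2"
    using even_holomorphic_sinh_quotient by blast
  have "(\<lambda>n. of_nat n ^ Suc 0 * exp (- w) ^ n) sums (\<alpha> w / w ^ (0 + 2))"
    if w: "w \<in> ball 0 1" "Re w > 0" for w
  proof -
    \<comment> \<open>In these variables \<open>1 - exp (-w) = y' * (y - y')\<close>, so
      \<open>exp (-w) / (1 - exp (-w))\<^sup>2\<close> becomes
      \<open>1 / (y - y')\<^sup>2\<close>.\<close>
    define y y' where "y = exp (w/2)" and "y' = exp (-(w/2))"
    have yy: "y * y' = 1" unfolding y_def y'_def by (simp flip: exp_add)
    have z: "exp (-w) = y'\<^sup>2" unfolding y'_def by (simp flip: exp_of_nat_mult)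
    have [simp]: "w \<noteq> 0" using w by auto
    have n1: "norm (exp (-w)) < 1" using w by simp
    have ne: "1 - exp (-w) \<noteq> 0" using n1 by (metis norm_one less_irrefl right_minus_eq)
    have fac: "1 - y'\<^sup>2 = y' * (y - y')" using yy by (simp add: algebra_simps power2_eq_square)
    \<comment> \<open>The differentiated geometric series times \<open>exp (-w)\<close> is the
      wanted series from index 1 on; its term at index 0 vanishes.\<close>
    have "(\<lambda>n. exp (-w) * (of_nat (Suc n) * exp (-w) ^ n)) sums (exp (-w) * (1 / (1 - exp (-w))\<^sup>2))"
      by (intro sums_mult geometric_deriv_sums n1)
    also have "(\<lambda>n. exp (-w) * (of_nat (Suc n) * exp (-w) ^ n)) = (\<lambda>n. of_nat (Suc n) ^ Suc 0 * exp (-w) ^ Suc n)"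
      by (simp add: fun_eq_iff algebra_simps)
    finally have "(\<lambda>n. of_nat n ^ Suc 0 * exp (- w) ^ n) sums (exp (-w) * (1 / (1 - exp (-w))\<^sup>2))"
      by (subst (asm) sums_Suc_iff) simp
    also have "exp (-w) * (1 / (1 - exp (-w))\<^sup>2) = 1 / (y - y')\<^sup>2"
      unfolding z using ne unfolding z fac by (auto simp: power_mult_distrib)
    also have "\<dots> = \<alpha> w / w ^ (0 + 2)"
      using \<alpha>(3)[of w] w by (simp add: y_def y'_def power_divide power2_eq_square)
    finally show ?thesis .
  qed
  with \<alpha> show ?case by (intro exI[of _ \<alpha>]) blast
next
  case (Suc a)
  then obtain \<alpha> where \<alpha>: "\<alpha> holomorphic_on ball 0 1" "\<And>w. w \<in> ball 0 1 \<Longrightarrow> \<alpha> (-w) = \<alpha> w"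
    "\<And>w. w \<in> ball 0 1 \<Longrightarrow> Re w > 0 \<Longrightarrow>
      (\<lambda>n. of_nat n ^ Suc a * exp (- w) ^ n) sums (\<alpha> w / w ^ (a + 2))" by blast
  define \<beta> where "\<beta> = (\<lambda>w. of_nat (a + 2) * \<alpha> w - w * deriv \<alpha> w)"
  have der: "(\<alpha> has_field_derivative deriv \<alpha> w) (at w)" if "w \<in> ball 0 1" for w
    using \<alpha>(1) that by (intro holomorphic_derivI) auto
  \<comment> \<open>The derivative of an even function is odd, so
    \<open>w * deriv \<alpha> w\<close> is even, and with it \<open>\<beta>\<close>.\<close>
  have odd: "deriv \<alpha> (-w) = - deriv \<alpha> w" if "w \<in> ball 0 1" for w
  proof -
    have "((\<lambda>w. \<alpha> (-w)) has_field_derivative (deriv \<alpha> (-w) * (-1))) (at w)"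
      using that by (intro DERIV_chain'[where g = \<alpha> and f = uminus] der)
        (auto intro!: derivative_eq_intros)
    moreover have "((\<lambda>w. \<alpha> (-w)) has_field_derivative deriv \<alpha> w) (at w)"
      by (rule has_field_derivative_transform_within_open[OF der[OF that], of "ball 0 1"])
         (use \<alpha>(2) that in auto)
    ultimately show ?thesis using DERIV_unique by fastforce
  qed
  have "(\<lambda>n. of_nat n ^ Suc (Suc a) * exp (- w) ^ n) sums (\<beta> w / w ^ (Suc a + 2))"
    if w: "w \<in> ball 0 1" "Re w > 0" for w
  proof -
    let ?c = "\<lambda>n. of_nat n ^ Suc a :: complex"
    let ?z = "exp (-w)"
    have [simp]: "w \<noteq> 0" using w by auto
    have n1: "norm ?z < 1" using w by simp
    \<comment> \<open>The same function of \<open>w\<close> is differentiated twice over: as a power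
      series in \<open>exp (-w)\<close>, and as \<open>\<alpha> w / w ^ (a + 2)\<close> on the open
      half disc where the two agree. Uniqueness of the derivative equates the results.\<close>
    have "((\<lambda>z. \<Sum>n. ?c n * z ^ n) has_field_derivative (\<Sum>n. diffs ?c n * ?z ^ n)) (at ?z)"
      by (rule termdiffs_strong'[OF _ n1]) (rule summable_power_times_geometric)
    hence "((\<lambda>w. \<Sum>n. ?c n * exp (-w) ^ n) has_field_derivative
             ((\<Sum>n. diffs ?c n * ?z ^ n) * (- ?z))) (at w)"
      by (intro DERIV_chain'[where g = "\<lambda>z. \<Sum>n. ?c n * z ^ n" and f = "\<lambda>w. exp (-w)"])
         (auto intro!: derivative_eq_intros)
    moreover have "((\<lambda>w. \<Sum>n. ?c n * exp (-w) ^ n) has_field_derivative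
             ((deriv \<alpha> w * w ^ (a + 2) - \<alpha> w * (of_nat (a+2) * w ^ (a + 1))) / (w ^ (a+2))\<^sup>2)) (at w)"
    proof (rule has_field_derivative_transform_within_open)
      show "((\<lambda>w. \<alpha> w / w ^ (a + 2)) has_field_derivative
             ((deriv \<alpha> w * w ^ (a + 2) - \<alpha> w * (of_nat (a+2) * w ^ (a + 1))) / (w ^ (a+2))\<^sup>2)) (at w)"
        using DERIV_divide[OF der[OF w(1)] DERIV_power[OF DERIV_ident, of "a + 2"]]
        by (simp add: power2_eq_square)
      show "open (ball 0 1 \<inter> {w::complex. Re w > 0})"
        by (intro open_Int open_ball open_halfspace_Re_gt)
    qed (use w \<alpha>(3) in \<open>auto simp: sums_iff\<close>)
    ultimately have "(\<Sum>n. diffs ?c n * ?z ^ n) * (- ?z) =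
       ((deriv \<alpha> w * w ^ (a + 2) - \<alpha> w * (of_nat (a+2) * w ^ (a + 1))) / (w ^ (a+2))\<^sup>2)"
      by (rule DERIV_unique)
    also have "\<dots> = - (\<beta> w / w ^ (Suc a + 2))"
      unfolding \<beta>_def by (simp add: field_simps power2_eq_square)
    finally have eq: "?z * (\<Sum>n. diffs ?c n * ?z ^ n) = \<beta> w / w ^ (Suc a + 2)"
      by (simp add: algebra_simps)
    \<comment> \<open>\<open>eq\<close> concerns only the value of \<open>suminf\<close>; a
      \<open>sums\<close> statement also requires convergence.\<close>
    have "summable (\<lambda>n. of_nat n ^ Suc (Suc a) * ?z ^ n)"
      by (rule summable_power_times_geometric[OF n1])
    hence "summable (\<lambda>n. of_nat (Suc n) ^ Suc (Suc a) * ?z ^ Suc n)"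
      by (subst summable_Suc_iff)
    also have "(\<lambda>n. of_nat (Suc n) ^ Suc (Suc a) * ?z ^ Suc n) = (\<lambda>n. ?z * (diffs ?c n * ?z ^ n))"
      by (simp add: fun_eq_iff diffs_def algebra_simps)
    finally have "summable (\<lambda>n. diffs ?c n * ?z ^ n)"
      by (subst (asm) summable_cmult_iff) simp
    hence "(\<lambda>n. ?z * (diffs ?c n * ?z ^ n)) sums (\<beta> w / w ^ (Suc a + 2))"
      unfolding eq[symmetric] by (intro sums_mult summable_sums)
    also have "(\<lambda>n. ?z * (diffs ?c n * ?z ^ n)) = (\<lambda>n. of_nat (Suc n) ^ Suc (Suc a) * ?z ^ Suc n)"
      by (simp add: fun_eq_iff diffs_def algebra_simps)
    finally show ?thesis by (subst (asm) sums_Suc_iff) simp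
  qed
  moreover have "\<beta> holomorphic_on ball 0 1"
    unfolding \<beta>_def using \<alpha>(1) by (intro holomorphic_intros holomorphic_deriv) auto
  moreover have "\<beta> (-w) = \<beta> w" if "w \<in> ball 0 1" for w
    using that by (simp add: \<beta>_def odd \<alpha>(2))
  ultimately show ?case by (intro exI[of _ \<beta>]) blast
qed

text \<open>Only even powers occur in the Taylor expansion of an even function. The monomials will
  have explicit Mellin transforms, while the factor \<open>w ^ (2 * M)\<close> moves the convergence
  of the remainder to the left.\<close>

lemma even_holomorphic_expansion:
  fixes E :: "complex \<Rightarrow> complex"
  assumes "E holomorphic_on ball 0 r" "r > 0" "\<And>w. w \<in> ball 0 r \<Longrightarrow> E (-w) = E w"
  shows "\<exists>e h. h holomorphic_on ball 0 r \<and> (\<forall>w\<in>ball 0 r. h (-w) = h w) \<and>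
    (\<forall>w\<in>ball 0 r. E w = (\<Sum>j<M. e j * w ^ (2 * j)) + w ^ (2 * M) * h w)"
proof (induction M)
  case 0
  show ?case using assms by (intro exI[of _ "\<lambda>_. 0"] exI[of _ E]) auto
next
  case (Suc M)
  then obtain e h where h: "h holomorphic_on ball 0 r" "\<And>w. w \<in> ball 0 r \<Longrightarrow> h (-w) = h w"
    and E: "\<And>w. w \<in> ball 0 r \<Longrightarrow> E w = (\<Sum>j<M. e j * w ^ (2 * j)) + w ^ (2 * M) * h w" by blast
  \<comment> \<open>One induction step divides \<open>h - h 0\<close> by \<open>w\<close> twice. The
    first quotient \<open>k\<close> is odd, so it vanishes at 0 and the second division is again
    holomorphic.\<close>
  define g where "g = (\<lambda>w. h w - h 0)"
  define k where "k = (\<lambda>w. if w = 0 then deriv g 0 else g w / w)"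
  define l where "l = (\<lambda>w. if w = 0 then deriv k 0 else k w / w)"
  have g: "g holomorphic_on ball 0 r" unfolding g_def by (intro holomorphic_intros h)
  have k: "k holomorphic_on ball 0 r"
    by (rule pole_theorem_open_0[OF g]) (auto simp: k_def g_def)
  have odd: "k (-w) = - k w" if "w \<in> ball 0 r" "w \<noteq> 0" for w
    using that h(2)[of w] by (simp add: k_def g_def)
  have "k 0 = 0"
  proof -
    have "isCont k 0" using k \<open>r > 0\<close>
      by (metis centre_in_ball continuous_on_interior holomorphic_on_imp_continuous_on interior_open open_ball)
    hence 1: "(k \<longlongrightarrow> k 0) (at 0)" by (simp add: isCont_def)
    \<comment> \<open>Oddness is known only away from 0; continuity carries it to
      \<open>k 0 = - k 0\<close>.\<close>
    have "((\<lambda>w. k (-w)) \<longlongrightarrow> k 0) (at 0)"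
      using 1 by (intro filterlim_compose[OF 1] filterlim_atI tendsto_eq_intros) (auto simp: eventually_at_filter)
    moreover have "eventually (\<lambda>w. k (-w) = - k w) (at 0)"
      using odd \<open>r > 0\<close> by (auto simp: eventually_at intro!: exI[of _ r])
    ultimately have "((\<lambda>w. - k w) \<longlongrightarrow> k 0) (at 0)" by (rule Lim_transform_eventually)
    with tendsto_minus[OF 1] have "k 0 = - k 0" using tendsto_unique[OF at_neq_bot] by blast
    thus ?thesis by simp
  qed
  have l: "l holomorphic_on ball 0 r"
    by (rule pole_theorem_open_0[OF k]) (auto simp: l_def \<open>k 0 = 0\<close>)
  have "l (-w) = l w" if "w \<in> ball 0 r" for w
    using odd[OF that] by (auto simp: l_def)
  moreover have "h w = h 0 + w ^ 2 * l w" for w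
    using \<open>k 0 = 0\<close> by (auto simp: l_def k_def g_def power2_eq_square)
  hence "E w = (\<Sum>j<Suc M. (e(M := h 0)) j * w ^ (2 * j)) + w ^ (2 * Suc M) * l w" if "w \<in> ball 0 r" for w
  proof -
    have "E w = (\<Sum>j<M. e j * w ^ (2 * j)) + w ^ (2 * M) * (h 0 + w ^ 2 * l w)"
      using E[OF that] \<open>h w = h 0 + w ^ 2 * l w\<close> by simp
    thus ?thesis by (simp add: algebra_simps power2_eq_square)
  qed
  ultimately show ?case using l by (intro exI[of _ "e(M := h 0)"] exI[of _ l]) blast
qed

section \<open>Mellin transforms\<close>

text \<open>Around \<open>z0\<close> the integrand is expanded into powers of \<open>(z - z0) * L u\<close>; the bound
  \<open>exp (Re z0 * L + d * \<bar>L\<bar>) \<le> exp (\<sigma>1 * L) + exp (\<sigma>2 * L)\<close> justifies termwise integration.\<close>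

lemma holomorphic_laplace_integral:
  fixes L :: "'a \<Rightarrow> real" and f :: "'a \<Rightarrow> complex"
  assumes [measurable]: "L \<in> borel_measurable M" "f \<in> borel_measurable M"
    and int1: "integrable M (\<lambda>u. exp (\<sigma>1 * L u) * norm (f u))"
    and int2: "integrable M (\<lambda>u. exp (\<sigma>2 * L u) * norm (f u))"
  shows "(\<lambda>z. \<integral>u. exp (z * of_real (L u)) * f u \<partial>M) holomorphic_on {z. \<sigma>1 < Re z \<and> Re z < \<sigma>2}"
    (is "?F holomorphic_on ?S")
proof -
  have "\<exists>B. open B \<and> z0 \<in> B \<and> ?F holomorphic_on B" if z0: "z0 \<in> ?S" for z0
  proof -
    \<comment> \<open>The distance from \<open>z0\<close> to the boundary of the strip, so that the
      power series is valid on the whole disc of this radius.\<close>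
    define r where "r = min (Re z0 - \<sigma>1) (\<sigma>2 - Re z0)"
    have "r > 0" using z0 by (simp add: r_def)
    define D where "D = (\<lambda>u. exp (\<sigma>1 * L u) * norm (f u) + exp (\<sigma>2 * L u) * norm (f u))"
    have D: "integrable M D" unfolding D_def by (intro Bochner_Integration.integrable_add int1 int2)
    define c where "c = (\<lambda>k. \<integral>u. exp (z0 * of_real (L u)) * f u * (of_real (L u) ^ k / fact k) \<partial>M)"
    have "(\<lambda>k. c k * (w - z0) ^ k) sums ?F w" if w: "w \<in> ball z0 r" for w
    proof -
      define d where "d = norm (w - z0)"
      have d: "0 \<le> d" "d \<le> Re z0 - \<sigma>1" "d \<le> \<sigma>2 - Re z0"
        using w by (auto simp: d_def dist_norm norm_minus_commute r_def)
      define g where "g = (\<lambda>k u. exp (z0 * of_real (L u)) * f u * (of_real (L u) ^ k / fact k) * (w - z0) ^ k)"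
      have g_sums: "(\<lambda>k. g k u) sums (exp (w * of_real (L u)) * f u)" for u
      proof -
        have "(\<lambda>k. exp (z0 * of_real (L u)) * f u * (((w - z0) * of_real (L u)) ^ k /\<^sub>R fact k)) sums
                (exp (z0 * of_real (L u)) * f u * exp ((w - z0) * of_real (L u)))"
          by (intro sums_mult exp_converges)
        also have "(\<lambda>k. exp (z0 * of_real (L u)) * f u * (((w - z0) * of_real (L u)) ^ k /\<^sub>R fact k)) = (\<lambda>k. g k u)"
          by (simp add: g_def fun_eq_iff scaleR_conv_of_real power_mult_distrib divide_inverse mult_ac)
        also have "exp (z0 * of_real (L u)) * f u * exp ((w - z0) * of_real (L u)) = exp (w * of_real (L u)) * f u"
          by (simp add: algebra_simps flip: exp_add)
        finally show ?thesis .
      qed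
      have norm_g: "norm (g k u) = exp (Re z0 * L u) * norm (f u) * ((d * \<bar>L u\<bar>) ^ k /\<^sub>R fact k)" for k u
        by (simp add: g_def norm_mult norm_divide norm_power d_def power_mult_distrib field_simps)
      have norm_sums: "(\<lambda>k. norm (g k u)) sums (exp (Re z0 * L u) * norm (f u) * exp (d * \<bar>L u\<bar>))" for u
        unfolding norm_g by (intro sums_mult exp_converges)
      have le_D: "exp (Re z0 * L u) * norm (f u) * exp (d * \<bar>L u\<bar>) \<le> D u" for u
      proof -
        have "exp (Re z0 * L u) * exp (d * \<bar>L u\<bar>) \<le> exp (\<sigma>1 * L u) + exp (\<sigma>2 * L u)"
        proof (cases "L u \<ge> 0")
          case True
          have "(Re z0 + d) * L u \<le> \<sigma>2 * L u" using True d by (intro mult_right_mono) auto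
          hence "exp (Re z0 * L u + d * \<bar>L u\<bar>) \<le> exp (\<sigma>2 * L u)" using True by (simp add: algebra_simps)
          thus ?thesis unfolding exp_add[symmetric] by (smt (verit) exp_gt_zero)
        next
          case False
          have "(Re z0 - d) * L u \<le> \<sigma>1 * L u" using False d by (intro mult_right_mono_neg) auto
          hence "exp (Re z0 * L u + d * \<bar>L u\<bar>) \<le> exp (\<sigma>1 * L u)" using False by (simp add: algebra_simps)
          thus ?thesis unfolding exp_add[symmetric] by (smt (verit) exp_gt_zero)
        qed
        hence "(exp (Re z0 * L u) * exp (d * \<bar>L u\<bar>)) * norm (f u) \<le> (exp (\<sigma>1 * L u) + exp (\<sigma>2 * L u)) * norm (f u)"
          by (intro mult_right_mono) auto
        thus ?thesis by (simp add: D_def algebra_simps)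
      qed
      \<comment> \<open>A bound on all partial sums by the one integrable function \<open>D\<close>
        gives both the integrability of each term and the summability of the integrated
        norms.\<close>
      have part: "(\<Sum>k\<in>A. norm (g k u)) \<le> D u" if "finite A" for A u
        using sum_le_suminf[of "\<lambda>k. norm (g k u)" A] norm_sums[of u] le_D[of u] that
        by (auto simp: sums_iff)
      have intg: "integrable M (g k)" for k
        by (rule Bochner_Integration.integrable_bound[OF D])
           (use part[of "{k}"] in \<open>auto simp: g_def intro: order_trans[OF _ abs_ge_self]\<close>)
      have "summable (\<lambda>k. \<integral>u. norm (g k u) \<partial>M)"
      proof (rule summableI_nonneg_bounded)
        fix N
        have "(\<Sum>k<N. \<integral>u. norm (g k u) \<partial>M) = (\<integral>u. (\<Sum>k<N. norm (g k u)) \<partial>M)"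
          using intg by (subst Bochner_Integration.integral_sum) auto
        also have "\<dots> \<le> (\<integral>u. D u \<partial>M)"
          using intg D part by (intro integral_mono) auto
        finally show "(\<Sum>k<N. \<integral>u. norm (g k u) \<partial>M) \<le> (\<integral>u. D u \<partial>M)" .
      qed auto
      hence "(\<lambda>k. \<integral>u. g k u \<partial>M) sums (\<integral>u. (\<Sum>k. g k u) \<partial>M)"
        using norm_sums by (intro sums_integral intg) (auto simp: sums_iff)
      also have "(\<lambda>u. \<Sum>k. g k u) = (\<lambda>u. exp (w * of_real (L u)) * f u)"
        using g_sums by (simp add: sums_iff)
      finally show ?thesis by (simp add: g_def c_def)
    qed
    hence "?F holomorphic_on ball z0 r" by (rule power_series_holomorphic)
    thus ?thesis using \<open>r > 0\<close> by (intro exI[of _ "ball z0 r"]) auto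
  qed
  hence "?F field_differentiable at z0" if "z0 \<in> ?S" for z0
    using that holomorphic_on_imp_differentiable_at by blast
  thus ?thesis unfolding holomorphic_on_def using field_differentiable_at_within by blast
qed

text \<open>The integral of \<open>u powr (s - 1)\<close> over \<open>(0, \<rho>)\<close>. The
  integrand is written with \<open>exp (s * ln u)\<close> so as to fit
  \<open>holomorphic_laplace_integral\<close> with \<open>L = ln\<close>.\<close>

lemma has_bochner_integral_power_from_0:
  assumes "Re s > 0" "\<rho> > 0"
  shows "has_bochner_integral lborel
    (\<lambda>u. exp (s * of_real (ln u)) * (indicator {0<..<\<rho>} u / of_real u)) (exp (s * of_real (ln \<rho>)) / s)"
proof -
  let ?F = "\<lambda>u. exp (s * of_real (ln u)) / s"
  let ?f = "\<lambda>u. exp (s * of_real (ln u)) / of_real u"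
  have [simp]: "s \<noteq> 0" using assms by auto
  have tend0: "((\<lambda>u. exp (\<sigma> * ln u) / \<sigma>) \<longlongrightarrow> 0) (at_right 0)" if "\<sigma> > 0" for \<sigma> :: real
    using that by real_asymp
  \<comment> \<open>For the modulus, a nonnegative integrand, the fundamental theorem yields
    integrability itself. The complex integrand is dominated by it, and only then evaluated.\<close>
  have int: "set_integrable lborel (einterval 0 (ereal \<rho>)) (\<lambda>u. exp (Re s * ln u) / u)"
  proof (rule interval_integral_FTC_nonneg(1)[where A = 0 and B = "exp (Re s * ln \<rho>) / Re s"])
    fix u assume u: "0 < ereal u" "ereal u < ereal \<rho>"
    hence "u > 0" by simp
    show "DERIV (\<lambda>u. exp (Re s * ln u) / Re s) u :> exp (Re s * ln u) / u"
      using \<open>u > 0\<close> assms by (auto intro!: derivative_eq_intros)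
    show "isCont (\<lambda>u. exp (Re s * ln u) / u) u"
      using \<open>u > 0\<close> by (intro continuous_intros) auto
  next
    show "AE u in lborel. 0 < ereal u \<longrightarrow> ereal u < ereal \<rho> \<longrightarrow> 0 \<le> exp (Re s * ln u) / u" by auto
    show "(((\<lambda>u. exp (Re s * ln u) / Re s) \<circ> real_of_ereal) \<longlongrightarrow> 0) (at_right 0)"
      using tend0[of "Re s"] assms by (simp add: ereal_tendsto_simps zero_ereal_def)
    have "((\<lambda>u. exp (Re s * ln u) / Re s) \<longlongrightarrow> exp (Re s * ln \<rho>) / Re s) (at_left \<rho>)"
      using assms by (intro tendsto_intros) auto
    thus "(((\<lambda>u. exp (Re s * ln u) / Re s) \<circ> real_of_ereal) \<longlongrightarrow> exp (Re s * ln \<rho>) / Re s) (at_left (ereal \<rho>))"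
      by (simp add: ereal_tendsto_simps)
  qed (use assms in auto)
  have int': "set_integrable lborel (einterval 0 (ereal \<rho>)) ?f"
    unfolding set_integrable_def
  proof (rule Bochner_Integration.integrable_bound[OF int[unfolded set_integrable_def]])
    show "(\<lambda>u. indicat_real (einterval 0 (ereal \<rho>)) u *\<^sub>R ?f u) \<in> borel_measurable lborel"
      by measurable
  qed (auto simp: indicator_def norm_divide)
  have "(LBINT u=0..ereal \<rho>. ?f u) = exp (s * of_real (ln \<rho>)) / s - 0"
  proof (rule interval_integral_FTC_integrable[OF _ _ _ int'])
    fix u assume u: "0 < ereal u" "ereal u < ereal \<rho>"
    hence "u > 0" by simp
    show "(?F has_vector_derivative ?f u) (at u)"
    proof -
      have "((\<lambda>u. complex_of_real (ln u)) has_vector_derivative of_real (1 / u)) (at u)"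
        using \<open>u > 0\<close> by (intro has_vector_derivative_of_real DERIV_ln_divide)
      moreover have "((\<lambda>z. exp (s * z) / s) has_field_derivative exp (s * of_real (ln u))) (at (of_real (ln u)))"
        by (auto intro!: derivative_eq_intros)
      ultimately show ?thesis
        using field_vector_diff_chain_at by (fastforce simp: o_def)
    qed
    show "isCont ?f u" using \<open>u > 0\<close> by (intro continuous_intros) auto
  next
    have "((\<lambda>u. norm (?F u)) \<longlongrightarrow> 0) (at_right 0)"
    proof -
      have "((\<lambda>u. exp (Re s * ln u) / Re s * (Re s / norm s)) \<longlongrightarrow> 0 * (Re s / norm s)) (at_right 0)"
        by (intro tendsto_intros tend0 assms)
      thus ?thesis using assms by (simp add: norm_divide)
    qed
    hence "(?F \<longlongrightarrow> 0) (at_right 0)" by (rule tendsto_norm_zero_cancel)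
    thus "((?F \<circ> real_of_ereal) \<longlongrightarrow> 0) (at_right 0)" 
      by (simp add: ereal_tendsto_simps zero_ereal_def)
    have "(?F \<longlongrightarrow> ?F \<rho>) (at_left \<rho>)"
      using assms by (intro tendsto_intros) auto
    thus "((?F \<circ> real_of_ereal) \<longlongrightarrow> ?F \<rho>) (at_left (ereal \<rho>))"
      by (simp add: ereal_tendsto_simps)
  qed (use assms in auto)
  hence "(LBINT u:einterval 0 (ereal \<rho>). ?f u) = exp (s * of_real (ln \<rho>)) / s"
    using assms by (simp add: interval_lebesgue_integral_def)
  with int' have "has_bochner_integral lborel (\<lambda>u. indicat_real (einterval 0 (ereal \<rho>)) u *\<^sub>R ?f u) (exp (s * of_real (ln \<rho>)) / s)"
    unfolding set_integrable_def set_lebesgue_integral_def by (simp add: has_bochner_integral_iff)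
  also have "einterval 0 (ereal \<rho>) = {0<..<\<rho>}" by (auto simp: einterval_def)
  finally show ?thesis by (rule has_bochner_integral_cong[THEN iffD1, rotated 3]) (auto simp: indicator_def)
qed

text \<open>Euler's integral after the substitution of \<open>\<kappa> * u\<close> for
  \<open>u\<close>; later \<open>\<kappa>\<close> is \<open>n + m * x\<close>.\<close>

lemma has_bochner_integral_Gamma_scaled:
  assumes "Re t > 0" "\<kappa> > 0"
  shows "has_bochner_integral lborel
    (\<lambda>u. exp (t * of_real (ln u)) * (indicator {0<..} u * exp (- of_real (\<kappa> * u)) / of_real u))
    (Gamma t * exp (- t * of_real (ln \<kappa>)))"
proof -
  let ?f = "\<lambda>u. exp (t * of_real (ln u)) * (indicator {0<..} u * exp (- of_real u) / of_real u)"
  have eq: "exp (t * of_real (ln u)) / of_real u * exp (- of_real u) = 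
             of_real u powr (t - 1) / of_real (exp u)" if "u > 0" for u
    using that by (simp add: powr_def Ln_of_real exp_diff exp_minus field_simps exp_of_real)
  have si: "set_integrable lebesgue {0<..} (\<lambda>u. complex_of_real u powr (t - 1) / of_real (exp u))"
    using absolutely_integrable_Gamma_integral'[OF assms(1)] .
  hence "set_integrable lborel {0<..} (\<lambda>u. complex_of_real u powr (t - 1) / of_real (exp u))"
    unfolding set_integrable_def by (subst (asm) integrable_completion) measurable
  moreover from this have "(LBINT u:{0<..}. complex_of_real u powr (t - 1) / of_real (exp u)) = Gamma t"
    using set_borel_integral_eq_integral(2) Gamma_integral_complex'[OF assms(1)] integral_unique by metis
  ultimately have "has_bochner_integral lborel (\<lambda>u. indicat_real {0<..} u *\<^sub>R (complex_of_real u powr (t - 1) / of_real (exp u))) (Gamma t)"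
    unfolding set_integrable_def set_lebesgue_integral_def by (simp add: has_bochner_integral_iff)
  also have "(\<lambda>u. indicat_real {0<..} u *\<^sub>R (complex_of_real u powr (t - 1) / of_real (exp u))) = ?f"
    using eq by (auto simp: fun_eq_iff indicator_def)
  finally have "has_bochner_integral lborel (\<lambda>u. ?f (0 + \<kappa> * u)) (Gamma t /\<^sub>R \<bar>\<kappa>\<bar>)"
    using assms(2) by (subst lborel_has_bochner_integral_real_affine_iff[symmetric]) auto
  \<comment> \<open>In the integrand this factor removes \<kappa> from
    \<open>ln (\<kappa> * u)\<close> and from the denominator; in the value it cancels the Jacobian
    and leaves the power of \<kappa>.\<close>
  hence "has_bochner_integral lborel (\<lambda>u. (of_real \<kappa> * exp (- t * of_real (ln \<kappa>))) * ?f (0 + \<kappa> * u))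
     ((of_real \<kappa> * exp (- t * of_real (ln \<kappa>))) * (Gamma t /\<^sub>R \<bar>\<kappa>\<bar>))"
    by (rule has_bochner_integral_mult_right)
  also have "(of_real \<kappa> * exp (- t * of_real (ln \<kappa>))) * (Gamma t /\<^sub>R \<bar>\<kappa>\<bar>) = Gamma t * exp (- t * of_real (ln \<kappa>))"
    using assms(2) by (simp add: scaleR_conv_of_real field_simps)
  also have "(\<lambda>u. (of_real \<kappa> * exp (- t * of_real (ln \<kappa>))) * ?f (0 + \<kappa> * u)) =
     (\<lambda>u. exp (t * of_real (ln u)) * (indicator {0<..} u * exp (- of_real (\<kappa> * u)) / of_real u))"
  proof
    fix u :: real
    show "(of_real \<kappa> * exp (- t * of_real (ln \<kappa>))) * ?f (0 + \<kappa> * u) =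
      exp (t * of_real (ln u)) * (indicator {0<..} u * exp (- of_real (\<kappa> * u)) / of_real u)"
    proof (cases "u > 0")
      case True
      have "exp (t * of_real (ln (\<kappa> * u))) = exp (t * of_real (ln \<kappa>)) * exp (t * of_real (ln u))"
        using True assms(2) by (simp add: ln_mult algebra_simps flip: exp_add)
      thus ?thesis using True assms(2) by (simp add: exp_minus field_simps)
    qed (use assms(2) in \<open>auto simp: indicator_def zero_less_mult_iff\<close>)
  qed
  finally show ?thesis .
qed

text \<open>Two applications of \<open>integral_suminf\<close>, inner sum first. The product bound
  \<open>p n * q m\<close> controls the integrated norms in both.\<close>

lemma integral_double_suminf:
  fixes f :: "nat \<Rightarrow> nat \<Rightarrow> 'a \<Rightarrow> complex"
  assumes int: "\<And>n m. integrable M (f n m)"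
    and bound: "\<And>n m. (\<integral>u. norm (f n m u) \<partial>M) \<le> p n * q m"
    and pq: "summable p" "summable q" "\<And>n. p n \<ge> 0" 
    and s1: "\<And>n u. summable (\<lambda>m. norm (f n m u))"
    and s2: "\<And>u. summable (\<lambda>n. \<Sum>m. norm (f n m u))"
  shows "integrable M (\<lambda>u. \<Sum>n. \<Sum>m. f n m u)"
    and "(\<integral>u. (\<Sum>n. \<Sum>m. f n m u) \<partial>M) = (\<Sum>n. \<Sum>m. \<integral>u. f n m u \<partial>M)"
proof -
  have sm: "summable (\<lambda>m. \<integral>u. norm (f n m u) \<partial>M)" for n
    by (rule summable_comparison_test'[OF summable_mult[OF pq(2), of "p n"]]) (use bound in auto)
  have in1: "integrable M (\<lambda>u. \<Sum>m. f n m u)" for n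
    by (intro integrable_suminf int sm) (use s1 in auto)
  have eq1: "(\<integral>u. (\<Sum>m. f n m u) \<partial>M) = (\<Sum>m. \<integral>u. f n m u \<partial>M)" for n
    by (intro integral_suminf int sm) (use s1 in auto)
  have le: "norm (\<Sum>m. f n m u) \<le> (\<Sum>m. norm (f n m u))" for n u
    by (intro summable_norm s1)
  have "norm (\<integral>u. norm (\<Sum>m. f n m u) \<partial>M) \<le> p n * suminf q" for n
  proof -
    have in2: "integrable M (\<lambda>u. \<Sum>m. norm (f n m u))"
      by (intro integrable_suminf integrable_norm int) (use s1 sm in auto)
    have "(\<integral>u. norm (\<Sum>m. f n m u) \<partial>M) \<le> (\<integral>u. (\<Sum>m. norm (f n m u)) \<partial>M)"
      by (intro integral_mono integrable_norm in1 in2 le)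
    also have "\<dots> = (\<Sum>m. \<integral>u. norm (f n m u) \<partial>M)"
      by (intro integral_suminf integrable_norm int) (use s1 sm in auto)
    also have "\<dots> \<le> (\<Sum>m. p n * q m)" by (intro suminf_le bound sm summable_mult pq)
    also have "\<dots> = p n * suminf q" by (intro suminf_mult pq)
    finally show ?thesis by simp
  qed
  hence sn: "summable (\<lambda>n. \<integral>u. norm (\<Sum>m. f n m u) \<partial>M)"
    by (intro summable_comparison_test'[OF summable_mult2[OF pq(1), of "suminf q"]]) auto
  have sp: "summable (\<lambda>n. norm (\<Sum>m. f n m u))" for u
    by (rule summable_comparison_test'[OF s2[of u]]) (use le in auto)
  show "integrable M (\<lambda>u. \<Sum>n. \<Sum>m. f n m u)"
    by (intro integrable_suminf in1 sn) (use sp in auto)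
  show "(\<integral>u. (\<Sum>n. \<Sum>m. f n m u) \<partial>M) = (\<Sum>n. \<Sum>m. \<integral>u. f n m u \<partial>M)"
    unfolding eq1[symmetric] by (intro integral_suminf in1 sn) (use sp in auto)
qed

section \<open>The Mordell--Tornheim series as a Mellin transform\<close>

text \<open>The product bound makes both sums absolutely convergent, and the vanishing row and
  column at index 0 allow the index sets to grow to all naturals.\<close>

lemma infsum_infsum_eq_suminf:
  fixes f :: "nat \<Rightarrow> nat \<Rightarrow> complex"
  assumes bound: "\<And>n m. norm (f n m) \<le> p n * q m" and pq: "summable p" "summable q"
    and zero: "\<And>m. f 0 m = 0" "\<And>n. f n 0 = 0"
  shows "(\<Sum>\<^sub>\<infinity>n\<in>{1..}. \<Sum>\<^sub>\<infinity>m\<in>{1..}. f n m) = (\<Sum>n. \<Sum>m. f n m)"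
proof -
  have sm: "summable (\<lambda>m. norm (f n m))" for n
    by (rule summable_comparison_test'[OF summable_mult[OF pq(2), of "p n"]]) (use bound in auto)
  have eq: "(\<Sum>\<^sub>\<infinity>m\<in>{1..}. f n m) = (\<Sum>m. f n m)" for n
  proof -
    have "(\<Sum>\<^sub>\<infinity>m\<in>{1..}. f n m) = (\<Sum>\<^sub>\<infinity>m\<in>UNIV. f n m)"
      by (intro infsum_cong_neutral) (auto simp: not_le zero)
    thus ?thesis
      using norm_summable_imp_has_sum[OF sm summable_sums[OF summable_norm_cancel[OF sm]]] infsumI by metis
  qed
  have "norm (\<Sum>m. f n m) \<le> p n * suminf q" for n
  proof -
    have "norm (\<Sum>m. f n m) \<le> (\<Sum>m. norm (f n m))" by (intro summable_norm sm)
    also have "\<dots> \<le> (\<Sum>m. p n * q m)" by (intro suminf_le bound sm summable_mult pq)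
    also have "\<dots> = p n * suminf q" by (intro suminf_mult pq)
    finally show ?thesis .
  qed
  hence sn: "summable (\<lambda>n. norm (\<Sum>m. f n m))"
    by (intro summable_comparison_test'[OF summable_mult2[OF pq(1), of "suminf q"]]) auto
  have "(\<Sum>\<^sub>\<infinity>n\<in>{1..}. \<Sum>\<^sub>\<infinity>m\<in>{1..}. f n m) = (\<Sum>\<^sub>\<infinity>n\<in>UNIV. \<Sum>m. f n m)"
    unfolding eq by (intro infsum_cong_neutral) (auto simp: not_le zero)
  thus ?thesis
    using norm_summable_imp_has_sum[OF sn summable_sums[OF summable_norm_cancel[OF sn]]] infsumI by metis
qed

text \<open>This is \<open>A\<^sub>a\<close>, kept as a power series in \<open>exp (- u)\<close>.
  Convergence may fail for \<open>u \<le> 0\<close>, which the indicator in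
  \<open>mellin_density\<close> cuts off.\<close>

definition power_exp_sum :: "nat \<Rightarrow> real \<Rightarrow> complex"
  where "power_exp_sum a u = (\<Sum>n. of_nat n ^ a * exp (- of_real u) ^ n)"

text \<open>Division by \<open>u\<close> absorbs the Mellin measure \<open>du / u\<close>, so that
  the kernel is exactly \<open>exp (t * ln u)\<close>.\<close>

definition mellin_density :: "nat \<Rightarrow> nat \<Rightarrow> real \<Rightarrow> real \<Rightarrow> complex"
  where "mellin_density a b x u =
    indicator {0<..} u * (power_exp_sum a u * power_exp_sum b (x * u)) / of_real u"

lemma measurable_power_exp_sum [measurable]: "power_exp_sum a \<in> borel_measurable borel"
  unfolding power_exp_sum_def by measurable

lemma measurable_mellin_density [measurable]: "mellin_density a b x \<in> borel_measurable borel"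
  unfolding mellin_density_def by measurable

text \<open>The number \<open>n + m * x\<close> is at least \<open>n\<close> and at least
  \<open>m * x\<close>, hence its square is at least their product. This decouples the two indices.
  For \<open>n = 0\<close> or \<open>m = 0\<close> the left side vanishes because \<open>a\<close>
  and \<open>b\<close> are positive.\<close>

lemma mordell_tornheim_term_bound:
  fixes x \<sigma> :: real
  assumes "x > 0" "\<sigma> > 0" "a > 0" "b > 0"
  shows "real n ^ a * real m ^ b * exp (- \<sigma> * ln (real n + real m * x)) \<le>
    real n powr (a - \<sigma> / 2) * (x powr (- \<sigma> / 2) * real m powr (b - \<sigma> / 2))"
proof (cases "n = 0 \<or> m = 0")
  case False
  hence n: "n > 0" "m > 0" by auto
  have "ln (real n) \<le> ln (real n + real m * x)" "ln (real m * x) \<le> ln (real n + real m * x)"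
    using n assms(1) by (auto simp: add_pos_pos)
  hence "\<sigma> * (ln (real n) + ln (real m * x)) \<le> \<sigma> * (2 * ln (real n + real m * x))"
    using assms by (intro mult_left_mono) auto
  hence "exp (- \<sigma> * ln (real n + real m * x)) \<le> exp (- \<sigma>/2 * ln (real n) + (- \<sigma>/2 * ln x + - \<sigma>/2 * ln (real m)))"
    using n assms(1) by (simp add: ln_mult algebra_simps)
  also have "\<dots> = real n powr (-\<sigma>/2) * (x powr (-\<sigma>/2) * real m powr (-\<sigma>/2))"
    using n assms(1) unfolding exp_add by (simp add: powr_def)
  finally have "real n ^ a * real m ^ b * exp (- \<sigma> * ln (real n + real m * x)) \<le>
     real n ^ a * real m ^ b * (real n powr (-\<sigma>/2) * (x powr (-\<sigma>/2) * real m powr (-\<sigma>/2)))"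
    by (intro mult_left_mono) auto
  also have "\<dots> = (real n powr a * real n powr (-\<sigma>/2)) * (x powr (-\<sigma>/2) * (real m powr b * real m powr (-\<sigma>/2)))"
    using n by (simp add: powr_realpow)
  finally show ?thesis unfolding powr_add[symmetric] by simp
qed (use assms in \<open>auto simp: zero_power\<close>)

text \<open>Expanding both exponential sums and integrating termwise, each pair
  \<open>(n, m)\<close> contributes \<open>Gamma t\<close> times its term of the series.\<close>

lemma mellin_mordell_tornheim:
  assumes x: "x > 0" and ab: "a > 0" "b > 0" and t: "Re t > 2 * real (a + b + 2)"
  shows "integrable lborel (\<lambda>u. exp (t * of_real (ln u)) * mellin_density a b x u)"
    and "(\<integral>u. exp (t * of_real (ln u)) * mellin_density a b x u \<partial>lborel) =
      Gamma t * mordell_tornheim_series (- of_nat a) (- of_nat b) t x"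
proof -
  define \<sigma> where "\<sigma> = Re t"
  have \<sigma>: "\<sigma> > 0" using t by (simp add: \<sigma>_def)
  define p where "p = (\<lambda>n. real n powr (a - \<sigma> / 2))"
  define q where "q = (\<lambda>m. x powr (- \<sigma> / 2) * real m powr (b - \<sigma> / 2))"
  \<comment> \<open>The threshold on \<open>Re t\<close> pushes both exponents
    \<open>a - \<sigma> / 2\<close> and \<open>b - \<sigma> / 2\<close> below -1.\<close>
  have p: "summable p" and q: "summable q"
    unfolding p_def q_def using t
    by (auto intro!: summable_mult simp: summable_real_powr_iff \<sigma>_def)
  define w where "w = (\<lambda>t n m u. of_nat n ^ a * of_nat m ^ b *
     (exp (t * of_real (ln u)) * (indicator {0<..} u * exp (- of_real ((real n + real m * x) * u)) / of_real u :: complex)))"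
  define T where "T = (\<lambda>t n m. of_nat n ^ a * of_nat m ^ b * exp (- t * of_real (ln (real n + real m * x))) :: complex)"
  have hb: "has_bochner_integral lborel (w t n m) (Gamma t * T t n m)" if "Re t > 0" for t n m
  proof (cases "n = 0")
    case True
    thus ?thesis using ab by (simp add: w_def T_def zero_power has_bochner_integral_zero)
  next
    case False
    hence "real n + real m * x > 0" using x by (simp add: add_pos_nonneg)
    from has_bochner_integral_mult_right[OF has_bochner_integral_Gamma_scaled[OF that this],
        of "of_nat n ^ a * of_nat m ^ b"]
    show ?thesis by (simp add: w_def T_def algebra_simps)
  qed
  have T_le: "norm (T s n m) \<le> p n * q m" if "Re s = \<sigma>" for s n m
    using mordell_tornheim_term_bound[OF x \<sigma> ab, of n m] that
    by (simp add: T_def p_def q_def norm_mult norm_power)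
  \<comment> \<open>The modulus of a term is the same term at the real exponent \<sigma>, so its
    integral is again given by \<open>hb\<close>.\<close>
  have norm_w: "norm (w t n m u) = Re (w (of_real \<sigma>) n m u)" for n m u
    by (simp add: w_def norm_mult norm_power norm_divide \<sigma>_def indicator_def exp_of_real Re_divide_of_real
        flip: of_real_mult of_real_power of_real_minus of_real_divide)
  have int_norm: "(\<integral>u. norm (w t n m u) \<partial>lborel) \<le> (norm (Gamma (of_real \<sigma> :: complex)) * p n) * q m" for n m
  proof -
    have "(\<integral>u. norm (w t n m u) \<partial>lborel) = Re (Gamma (of_real \<sigma>) * T (of_real \<sigma>) n m)"
      using has_bochner_integral_Re[OF hb[of "of_real \<sigma>" n m]] \<sigma> unfolding norm_w
      by (simp add: has_bochner_integral_iff)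
    also have "\<dots> \<le> norm (Gamma (of_real \<sigma> :: complex) * T (of_real \<sigma>) n m)" by (rule complex_Re_le_cmod)
    also have "\<dots> \<le> norm (Gamma (of_real \<sigma> :: complex)) * (p n * q m)"
      unfolding norm_mult by (intro mult_left_mono T_le) auto
    finally show ?thesis by (simp add: mult_ac)
  qed
  define C where "C = (\<lambda>u. exp (t * of_real (ln u)) / of_real u :: complex)"
  define g where "g = (\<lambda>u n. of_nat n ^ a * exp (- complex_of_real u) ^ n)"
  define h where "h = (\<lambda>u n. of_nat n ^ b * exp (- complex_of_real (x * u)) ^ n)"
  \<comment> \<open>For fixed \<open>u > 0\<close> the term factors into a function of
    \<open>n\<close> and a function of \<open>m\<close>; the double sum is therefore a product of
    two series.\<close>
  have w_pos: "w t n m u = (C u * g u n) * h u m" if "u > 0" for n m u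
    using that unfolding w_def C_def g_def h_def
    by (simp add: exp_add exp_diff exp_minus algebra_simps power_inverse divide_inverse flip: exp_of_nat_mult)
  have w_neg: "w t n m u = 0" if "\<not> u > 0" for n m u
    using that by (simp add: w_def)
  have sg: "summable (\<lambda>n. norm (g u n))" and sh: "summable (\<lambda>n. norm (h u n))" if "u > 0" for u
  proof -
    have "summable (\<lambda>n. norm (of_nat n ^ k * exp (- complex_of_real v) ^ n))" if "v > 0" for k v
    proof -
      have "summable (\<lambda>n. of_nat n ^ k * of_real (exp (-v)) ^ n :: complex)"
        using that by (intro summable_power_times_geometric) auto
      hence "summable (\<lambda>n. complex_of_real (real n ^ k * exp (-v) ^ n))" by simp
      hence "summable (\<lambda>n. real n ^ k * exp (-v) ^ n)" by (subst (asm) summable_of_real_iff)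
      thus ?thesis using that by (simp add: norm_mult norm_power)
    qed
    from this[of u a] this[of "x * u" b] show "summable (\<lambda>n. norm (g u n))" "summable (\<lambda>n. norm (h u n))"
      using that x by (simp_all add: g_def h_def)
  qed
  have s1: "summable (\<lambda>m. norm (w t n m u))" for n u
    by (cases "u > 0") (auto simp: w_pos w_neg norm_mult intro!: summable_mult sh)
  have s2: "summable (\<lambda>n. \<Sum>m. norm (w t n m u))" for u
  proof (cases "u > 0")
    case True
    have "(\<Sum>m. norm (w t n m u)) = (norm (C u) * norm (g u n)) * (\<Sum>m. norm (h u m))" for n
      using True by (simp add: w_pos norm_mult suminf_mult sh)
    thus ?thesis using True by (auto intro!: summable_mult2 summable_mult sg)
  qed (simp add: w_neg)
  have eq: "(\<Sum>n. \<Sum>m. w t n m u) = exp (t * of_real (ln u)) * mellin_density a b x u" for u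
  proof (cases "u > 0")
    case True
    note sg' = summable_norm_cancel[OF sg[OF True]] and sh' = summable_norm_cancel[OF sh[OF True]]
    have "(\<Sum>m. w t n m u) = (C u * g u n) * suminf (h u)" for n
      using True by (simp add: w_pos suminf_mult sh')
    hence "(\<Sum>n. \<Sum>m. w t n m u) = C u * suminf (g u) * suminf (h u)"
      by (simp add: suminf_mult suminf_mult2[symmetric] sg' summable_mult)
    thus ?thesis using True
      by (simp add: mellin_density_def power_exp_sum_def C_def g_def h_def)
  qed (simp add: w_neg mellin_density_def)
  have pos: "Re t > 0" using \<sigma> by (simp add: \<sigma>_def)
  have intw: "integrable lborel (w t n m)" for n m
    using hb[OF pos] by (simp add: has_bochner_integral_iff)
  have nonneg: "0 \<le> norm (Gamma (of_real \<sigma> :: complex)) * p n" for n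
    by (simp add: p_def)
  note D = integral_double_suminf[OF intw int_norm summable_mult[OF p] q nonneg s1 s2]
  show "integrable lborel (\<lambda>u. exp (t * of_real (ln u)) * mellin_density a b x u)"
    using D(1) unfolding eq .
  have "(\<integral>u. exp (t * of_real (ln u)) * mellin_density a b x u \<partial>lborel) = (\<Sum>n. \<Sum>m. Gamma t * T t n m)"
    using D(2) hb[OF pos] unfolding eq by (simp add: has_bochner_integral_iff)
  also have "\<dots> = (\<Sum>\<^sub>\<infinity>n\<in>{1..}. \<Sum>\<^sub>\<infinity>m\<in>{1..}. Gamma t * T t n m)"
  proof (rule infsum_infsum_eq_suminf[symmetric])
    show "norm (Gamma t * T t n m) \<le> (norm (Gamma t) * p n) * q m" for n m
      using T_le[of t n m] by (simp add: norm_mult \<sigma>_def mult.assoc mult_left_mono)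
  qed (use p q ab in \<open>auto simp: T_def zero_power intro: summable_mult\<close>)
  also have "\<dots> = Gamma t * (\<Sum>\<^sub>\<infinity>n\<in>{1..}. \<Sum>\<^sub>\<infinity>m\<in>{1..}. T t n m)"
    by (simp add: infsum_cmult_right')
  also have "(\<Sum>\<^sub>\<infinity>n\<in>{1..}. \<Sum>\<^sub>\<infinity>m\<in>{1..}. T t n m) = mordell_tornheim_series (- of_nat a) (- of_nat b) t x"
    unfolding mordell_tornheim_series_def
  proof (intro infsum_cong)
    fix n m :: nat assume "n \<in> {1..}" "m \<in> {1..}"
    hence nm: "n > 0" "m > 0" by auto
    hence pos: "real n + real m * x > 0" using x by (simp add: add_pos_pos)
    have "of_real (real n + real m * x) powr t = exp (t * of_real (ln (real n + real m * x)))"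
      using pos by (simp add: powr_def Ln_of_real del: of_real_add)
    thus "T t n m = 1 / (of_nat n powr - of_nat a * of_nat m powr - of_nat b * of_real (real n + real m * x) powr t)"
      using nm by (simp add: T_def powr_minus powr_nat field_simps exp_minus del: of_real_add)
  qed
  finally show "(\<integral>u. exp (t * of_real (ln u)) * mellin_density a b x u \<partial>lborel) =
      Gamma t * mordell_tornheim_series (- of_nat a) (- of_nat b) t x" .
qed

section \<open>Analytic continuation in one variable\<close>

text \<open>The numerators of the two exponential sums are even, and so is their product after
  rescaling the second argument by \<open>x\<close>.\<close>

lemma mellin_density_even_over_power:
  assumes x: "x > 0" and ab: "a > 0" "b > 0"
  obtains \<delta> E where "\<delta> > 0" "E holomorphic_on ball 0 \<delta>" "\<And>w. w \<in> ball 0 \<delta> \<Longrightarrow> E (-w) = E w"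
    "\<And>u. 0 < u \<Longrightarrow> u < \<delta> \<Longrightarrow> mellin_density a b x u = E (of_real u) / of_real u ^ (a + b + 2) / of_real u"
proof -
  obtain a' b' where a': "a = Suc a'" and b': "b = Suc b'" using ab by (metis gr0_implies_Suc)
  obtain \<alpha> where \<alpha>: "\<alpha> holomorphic_on ball 0 1" "\<And>w. w \<in> ball 0 1 \<Longrightarrow> \<alpha> (-w) = \<alpha> w"
    "\<And>w. w \<in> ball 0 1 \<Longrightarrow> Re w > 0 \<Longrightarrow> (\<lambda>n. of_nat n ^ a * exp (- w) ^ n) sums (\<alpha> w / w ^ (a + 1))"
    using power_times_exp_sums_even_over_power[of a'] unfolding a' by auto
  obtain \<beta> where \<beta>: "\<beta> holomorphic_on ball 0 1" "\<And>w. w \<in> ball 0 1 \<Longrightarrow> \<beta> (-w) = \<beta> w"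
    "\<And>w. w \<in> ball 0 1 \<Longrightarrow> Re w > 0 \<Longrightarrow> (\<lambda>n. of_nat n ^ b * exp (- w) ^ n) sums (\<beta> w / w ^ (b + 1))"
    using power_times_exp_sums_even_over_power[of b'] unfolding b' by auto
  \<comment> \<open>This radius keeps both \<open>w\<close> and \<open>x * w\<close> in the unit
    disc. The power of \<open>x\<close> in \<open>E\<close> comes from the denominator
    \<open>(x * w) ^ (b + 1)\<close>.\<close>
  define \<delta> where "\<delta> = min 1 (1 / x)"
  define E where "E = (\<lambda>w. \<alpha> w * \<beta> (of_real x * w) / of_real x ^ (b + 1))"
  have sub: "of_real x * w \<in> ball 0 1" "w \<in> ball 0 1" if "w \<in> ball 0 \<delta>" for w :: complex
    using that x by (auto simp: \<delta>_def norm_mult field_simps)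
  show ?thesis
  proof (rule that)
    show "\<delta> > 0" using x by (simp add: \<delta>_def)
    have "(\<beta> \<circ> (\<lambda>w. of_real x * w)) holomorphic_on ball 0 \<delta>"
      by (intro holomorphic_on_compose_gen[OF _ \<beta>(1)] holomorphic_intros) (use sub in auto)
    moreover have "\<alpha> holomorphic_on ball 0 \<delta>"
      by (rule holomorphic_on_subset[OF \<alpha>(1)]) (use sub in auto)
    ultimately show "E holomorphic_on ball 0 \<delta>"
      unfolding E_def using x by (intro holomorphic_intros) (auto simp: o_def)
    show "E (-w) = E w" if "w \<in> ball 0 \<delta>" for w
      using \<alpha>(2)[OF sub(2)[OF that]] \<beta>(2)[OF sub(1)[OF that]] by (simp add: E_def)
    fix u :: real assume u: "0 < u" "u < \<delta>"
    hence w: "of_real u \<in> ball (0::complex) \<delta>" by simp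
    have "power_exp_sum a u = \<alpha> (of_real u) / of_real u ^ (a + 1)"
      unfolding power_exp_sum_def using \<alpha>(3)[OF sub(2)[OF w]] u by (simp add: sums_iff)
    moreover have "power_exp_sum b (x * u) = \<beta> (of_real x * of_real u) / (of_real x * of_real u) ^ (b + 1)"
      unfolding power_exp_sum_def using \<beta>(3)[OF sub(1)[OF w]] u x by (simp add: sums_iff)
    ultimately show "mellin_density a b x u = E (of_real u) / of_real u ^ (a + b + 2) / of_real u"
      using u by (simp add: mellin_density_def E_def power_mult_distrib power_add)
  qed
qed

text \<open>Since the numerator of the density is even, poles can only occur at \<open>t = a + b + 2 - 2 * j\<close>, and
  the parity condition keeps \<open>- c\<close> away from them.\<close>

lemma mellin_density_continuation:
  fixes c :: nat
  assumes x: "x > 0" and ab: "a > 0" "b > 0" and odd: "odd (a + b + c)"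
    and R: "R > 2 * real (a + b + 2)"
  obtains H where "H holomorphic_on {t. - real c - 1 < Re t \<and> Re t < R} - \<int>"
    "isCont H (- of_nat c)"
    "\<And>t. 2 * real (a + b + 2) < Re t \<Longrightarrow> Re t < R \<Longrightarrow>
      H t = (\<integral>u. exp (t * of_real (ln u)) * mellin_density a b x u \<partial>lborel)"
proof -
  define K where "K = a + b + 2"
  \<comment> \<open>After division by \<open>u ^ K\<close> the remainder still carries
    \<open>u ^ (K + 2 * c)\<close>, so its Mellin integral converges for
    \<open>Re t > - (K + 2 * c)\<close>, a half plane containing
    \<open>Re t \<ge> - c - 1\<close>.\<close>
  define M where "M = K + c"
  let ?\<phi> = "mellin_density a b x"
  let ?S = "{t. - real c - 1 < Re t \<and> Re t < R}"
  obtain \<delta> E where \<delta>: "\<delta> > 0" and E: "E holomorphic_on ball 0 \<delta>"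
    "\<And>w. w \<in> ball 0 \<delta> \<Longrightarrow> E (-w) = E w"
    "\<And>u. 0 < u \<Longrightarrow> u < \<delta> \<Longrightarrow> ?\<phi> u = E (of_real u) / of_real u ^ K / of_real u"
  proof (rule mellin_density_even_over_power[OF x ab], goal_cases)
    case (1 \<delta> E)
    thus ?thesis by (intro that[of \<delta> E]) (auto simp: K_def)
  qed
  obtain e h where h: "h holomorphic_on ball 0 \<delta>"
    and Eh: "\<And>w. w \<in> ball 0 \<delta> \<Longrightarrow> E w = (\<Sum>j<M. e j * w ^ (2 * j)) + w ^ (2 * M) * h w"
    using even_holomorphic_expansion[OF E(1) \<delta> E(2), of M] by blast
  \<comment> \<open>Strictly inside the disc, so that \<open>h\<close> is bounded on the compact
    disc of radius \<rho>.\<close>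
  define \<rho> where "\<rho> = \<delta> / 2"
  have \<rho>: "\<rho> > 0" "\<rho> < \<delta>" using \<delta> by (auto simp: \<rho>_def)
  define s where "s = (\<lambda>t j. t + of_nat (2 * j) - of_nat K :: complex)"
  \<comment> \<open>The density splits into monomials near 0 (\<open>f1\<close>), the remainder near
    0 (\<open>f2\<close>) and the tail (\<open>f3\<close>).\<close>
  define f1 where "f1 = (\<lambda>j u. e j * (of_real u ^ (2 * j) / of_real u ^ K * (indicator {0<..<\<rho>} u / of_real u)))"
  define f2 where "f2 = (\<lambda>u. indicator {0<..<\<rho>} u * (of_real u ^ (K + 2 * c) * h (of_real u) / of_real u))"
  define f3 where "f3 = (\<lambda>u. indicator {\<rho>..} u * ?\<phi> u)"
  have split: "?\<phi> u = (\<Sum>j<M. f1 j u) + f2 u + f3 u" for u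
  proof (cases "0 < u \<and> u < \<rho>")
    case True
    hence "?\<phi> u = ((\<Sum>j<M. e j * of_real u ^ (2 * j)) + of_real u ^ (2 * M) * h (of_real u)) / of_real u ^ K / of_real u"
      using E(3)[of u] Eh[of "of_real u"] \<rho> by simp
    moreover have "complex_of_real u ^ (2 * M) = of_real u ^ K * of_real u ^ (K + 2 * c)"
      by (simp add: M_def flip: power_add)
    ultimately show ?thesis using True
      by (simp add: f1_def f2_def f3_def add_divide_distrib sum_divide_distrib)
  next
    case False
    thus ?thesis using \<rho>(1) by (auto simp: f1_def f2_def f3_def mellin_density_def indicator_def)
  qed
  \<comment> \<open>The integral converges only far to the right, but its value makes sense wherever
    \<open>s t j\<close> is nonzero; this value supplies the continuation.\<close>
  have hb1: "has_bochner_integral lborel (\<lambda>u. exp (t * of_real (ln u)) * f1 j u)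
      (e j * (exp (s t j * of_real (ln \<rho>)) / s t j))" if "Re t > real K" for t j
  proof -
    have "Re (s t j) > 0" using that by (simp add: s_def)
    note has_bochner_integral_mult_right[OF has_bochner_integral_power_from_0[OF this \<rho>(1)], of "e j"]
    also have "(\<lambda>u. e j * (exp (s t j * of_real (ln u)) * (indicator {0<..<\<rho>} u / of_real u))) =
      (\<lambda>u. exp (t * of_real (ln u)) * f1 j u)"
    proof
      fix u :: real
      have "exp (s t j * of_real (ln u)) = exp (t * of_real (ln u)) * (of_real u ^ (2 * j) / of_real u ^ K)" if "u > 0"
      proof -
        have "exp (of_nat n * complex_of_real (ln u)) = of_real u ^ n" for n
          using that by (simp add: exp_of_nat_mult exp_of_real)
        thus ?thesis by (simp add: s_def ring_distribs exp_add exp_diff del: of_nat_mult)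
      qed
      thus "e j * (exp (s t j * of_real (ln u)) * (indicator {0<..<\<rho>} u / of_real u)) =
        exp (t * of_real (ln u)) * f1 j u"
        by (cases "u > 0") (auto simp: f1_def)
    qed
    finally show ?thesis .
  qed
  have "continuous_on (cball 0 \<rho>) h"
    by (rule continuous_on_subset[OF holomorphic_on_imp_continuous_on[OF h]]) (use \<rho> in auto)
  hence "bounded (h ` cball 0 \<rho>)"
    by (intro compact_imp_bounded compact_continuous_image) auto
  then obtain C where C: "\<And>w. norm w \<le> \<rho> \<Longrightarrow> norm (h w) \<le> C"
    by (fastforce simp: bounded_iff)
  have f2_meas: "f2 \<in> borel_measurable lborel"
  proof -
    have "continuous_on {0<..<\<rho>} (\<lambda>u. of_real u ^ (K + 2 * c) * h (of_real u) / of_real u)"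
      using \<rho> by (intro continuous_intros continuous_on_compose2[OF holomorphic_on_imp_continuous_on[OF h]]) auto
    hence "(\<lambda>u. indicat_real {0<..<\<rho>} u *\<^sub>R (of_real u ^ (K + 2 * c) * h (of_real u) / of_real u)) \<in> borel_measurable borel"
      by (intro borel_measurable_continuous_on_indicator) auto
    also have "(\<lambda>u. indicat_real {0<..<\<rho>} u *\<^sub>R (of_real u ^ (K + 2 * c) * h (of_real u) / of_real u)) = f2"
      by (auto simp: f2_def indicator_def fun_eq_iff)
    finally show ?thesis by simp
  qed
  have f3_meas: "f3 \<in> borel_measurable lborel" unfolding f3_def by measurable
  note [measurable] = f2_meas f3_meas
  have int_normI: "integrable lborel (\<lambda>u. exp (Re t * ln u) * norm (f u)) \<longleftrightarrow>
      integrable lborel (\<lambda>u. exp (t * of_real (ln u)) * f u)"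
    if [measurable]: "f \<in> borel_measurable lborel" for f :: "real \<Rightarrow> complex" and t
    by (subst (2) integrable_norm_iff[symmetric]) (simp_all add: norm_mult)
  have int2: "integrable lborel (\<lambda>u. exp (t * of_real (ln u)) * f2 u)" if "Re t \<ge> - real c - 1" for t
  proof -
    have "Re (t + of_nat (K + 2 * c)) > 0" using that by (simp add: K_def)
    note integrable.intros[OF has_bochner_integral_power_from_0[OF this \<rho>(1)]]
    hence "integrable lborel (\<lambda>u. of_real C * (exp ((t + of_nat (K + 2 * c)) * of_real (ln u)) * (indicator {0<..<\<rho>} u / of_real u)))"
      by (rule integrable_mult_right)
    thus ?thesis
    proof (rule Bochner_Integration.integrable_bound, goal_cases)
      case 2
      have "norm (exp (t * of_real (ln u)) * f2 u) \<le> norm (of_real C * (exp ((t + of_nat (K + 2 * c)) * of_real (ln u)) * (indicator {0<..<\<rho>} u / of_real u)))" for u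
      proof (cases "u \<in> {0<..<\<rho>}")
        case True
        have "exp ((t + of_nat (K + 2 * c)) * of_real (ln u)) = exp (t * of_real (ln u)) * of_real u ^ (K + 2 * c)"
          using True by (simp add: ring_distribs exp_add exp_of_nat_mult exp_of_real del: of_nat_add of_nat_mult)
        moreover have "norm (h (of_real u)) \<le> \<bar>C\<bar>" using C[of "of_real u"] True by simp
        ultimately show ?thesis using True
          by (simp add: f2_def norm_mult norm_divide norm_power divide_right_mono mult_left_mono mult.commute[of C] mult.commute[of "\<bar>C\<bar>"])
      qed (simp add: f2_def)
      thus ?case by simp
    qed measurable
  qed
  have int\<phi>: "integrable lborel (\<lambda>u. exp (t * of_real (ln u)) * ?\<phi> u)" if "Re t > 2 * real (a + b + 2)" for t
    by (rule mellin_mordell_tornheim(1)[OF x ab that])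
  \<comment> \<open>On the tail \<open>u \<ge> \<rho>\<close> the factor
    \<open>u powr (Re t - R)\<close> is largest at \<rho>, so integrability at the right edge
    \<open>R\<close> of the strip extends to everything left of it.\<close>
  have int3: "integrable lborel (\<lambda>u. exp (t * of_real (ln u)) * f3 u)" if "Re t \<le> R" for t
  proof -
    have "integrable lborel (\<lambda>u. of_real (exp ((Re t - R) * ln \<rho>)) * (exp (of_real R * of_real (ln u)) * ?\<phi> u))"
      using int\<phi>[of "of_real R"] R by simp
    thus ?thesis
    proof (rule Bochner_Integration.integrable_bound, goal_cases)
      case 2
      have "norm (exp (t * of_real (ln u)) * f3 u) \<le> norm (of_real (exp ((Re t - R) * ln \<rho>)) * (exp (of_real R * of_real (ln u)) * ?\<phi> u))" for u
      proof (cases "u \<ge> \<rho>")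
        case True
        have "(Re t - R) * ln u \<le> (Re t - R) * ln \<rho>"
          using True that \<rho> by (intro mult_left_mono_neg) auto
        hence "exp (Re t * ln u) \<le> exp ((Re t - R) * ln \<rho>) * exp (R * ln u)"
          unfolding exp_add[symmetric] by (simp add: algebra_simps)
        hence "exp (Re t * ln u) * norm (?\<phi> u) \<le> exp ((Re t - R) * ln \<rho>) * exp (R * ln u) * norm (?\<phi> u)"
          by (intro mult_right_mono) auto
        thus ?thesis using True by (simp add: f3_def norm_mult mult_ac)
      qed (simp add: f3_def)
      thus ?case by simp
    qed measurable
  qed
  define F where "F = (\<lambda>f t. \<integral>u. exp (t * of_real (ln u)) * f u \<partial>lborel :: complex)"
  have hol: "F f holomorphic_on ?S"
    if "f \<in> borel_measurable lborel" "\<And>t. - real c - 1 \<le> Re t \<Longrightarrow> Re t \<le> R \<Longrightarrow> integrable lborel (\<lambda>u. exp (t * of_real (ln u)) * f u)" for f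
    unfolding F_def
    using int_normI[OF that(1), of "of_real (- real c - 1)"] int_normI[OF that(1), of "of_real R"]
      that(2)[of "of_real (- real c - 1)"] that(2)[of "of_real R"] R that(1)
    by (intro holomorphic_laplace_integral) auto
  have hol2: "F f2 holomorphic_on ?S" and hol3: "F f3 holomorphic_on ?S"
    by (auto intro!: hol int2 int3 f2_meas f3_meas)
  \<comment> \<open>The integrals of \<open>f1\<close> are replaced by their closed forms, with
    possible poles at \<open>t = K - 2 * j\<close>; the other two summands are holomorphic in the
    whole strip.\<close>
  define H where "H = (\<lambda>t. (\<Sum>j<M. e j * (exp (s t j * of_real (ln \<rho>)) / s t j)) + F f2 t + F f3 t)"
  show ?thesis
  proof (rule that[of H])
    have "s t j \<noteq> 0" if "t \<notin> \<int>" for t j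
    proof
      assume "s t j = 0"
      hence "t = of_nat K - of_nat (2 * j)" by (simp add: s_def algebra_simps add_eq_0_iff)
      thus False using that by (metis Ints_diff Ints_of_nat)
    qed
    thus "H holomorphic_on ?S - \<int>"
      unfolding H_def s_def
      by (intro holomorphic_intros holomorphic_on_subset[OF hol2] holomorphic_on_subset[OF hol3]) auto
  next
    have "s (- of_nat c) j \<noteq> 0" for j
    proof
      assume "s (- of_nat c) j = 0"
      hence "of_nat (2 * j) = (of_nat (K + c) :: complex)" by (simp add: s_def algebra_simps)
      hence "2 * j = K + c" unfolding of_nat_eq_iff .
      thus False using odd unfolding K_def by presburger
    qed
    moreover have "open ?S"
      by (simp add: Collect_conj_eq open_Int open_halfspace_Re_gt open_halfspace_Re_lt)
    hence "isCont (F f2) (- of_nat c)" "isCont (F f3) (- of_nat c)"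
      using R holomorphic_on_imp_continuous_on[OF hol2] holomorphic_on_imp_continuous_on[OF hol3]
      by (auto simp: continuous_on_eq_continuous_at)
    ultimately show "isCont H (- of_nat c)"
      unfolding H_def s_def by (intro continuous_intros) auto
  next
    fix t assume t: "2 * real (a + b + 2) < Re t" "Re t < R"
    have "Re t > real K" using t by (simp add: K_def)
    note hb1 = hb1[OF this]
    have i1: "integrable lborel (\<lambda>u. \<Sum>j<M. exp (t * of_real (ln u)) * f1 j u)"
      using hb1 by (intro Bochner_Integration.integrable_sum) (auto simp: has_bochner_integral_iff)
    have i2: "integrable lborel (\<lambda>u. exp (t * of_real (ln u)) * f2 u)" using t by (intro int2) auto
    have i3: "integrable lborel (\<lambda>u. exp (t * of_real (ln u)) * f3 u)" using t by (intro int3) auto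
    have "(\<integral>u. exp (t * of_real (ln u)) * ?\<phi> u \<partial>lborel) =
      (\<integral>u. (\<Sum>j<M. exp (t * of_real (ln u)) * f1 j u) + exp (t * of_real (ln u)) * f2 u + exp (t * of_real (ln u)) * f3 u \<partial>lborel)"
      by (simp add: split ring_distribs sum_distrib_left)
    also have "\<dots> = (\<integral>u. (\<Sum>j<M. exp (t * of_real (ln u)) * f1 j u) \<partial>lborel) + F f2 t + F f3 t"
      using i1 i2 i3 by (simp add: F_def)
    also have "(\<integral>u. (\<Sum>j<M. exp (t * of_real (ln u)) * f1 j u) \<partial>lborel) =
        (\<Sum>j<M. e j * (exp (s t j * of_real (ln \<rho>)) / s t j))"
      using hb1 by (subst Bochner_Integration.integral_sum) (auto simp: has_bochner_integral_iff)
    finally show "H t = (\<integral>u. exp (t * of_real (ln u)) * ?\<phi> u \<partial>lborel)" by (simp add: H_def)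
  qed
qed

section \<open>Restriction of \<open>\<Theta>\<close> to the line \<open>(r0, s0, t)\<close> and its
  limit at \<open>t0\<close>\<close>

lemma holomorphic3_on_imp_holomorphic_on:
  assumes "holomorphic3_on f U" "\<And>t. t \<in> A \<Longrightarrow> (r, s, t) \<in> U"
  shows "(\<lambda>t. f (r, s, t)) holomorphic_on A"
proof -
  have "(\<lambda>t. f (r, s, t)) field_differentiable (at t within A)" if "t \<in> A" for t
  proof -
    obtain a b c where "(f has_derivative (\<lambda>(u, v, w). a * u + b * v + c * w)) (at (r, s, t))"
      using bspec[OF assms(1)[unfolded holomorphic3_on_def] assms(2)[OF \<open>t \<in> A\<close>]] by blast
    moreover have "((\<lambda>t. (r, s, t)) has_derivative (\<lambda>w. (0, 0, w))) (at t)"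
      by (auto intro!: derivative_eq_intros)
    ultimately have "((f \<circ> (\<lambda>t. (r, s, t))) has_derivative
        ((\<lambda>(u, v, w). a * u + b * v + c * w) \<circ> (\<lambda>w. (0, 0, w)))) (at t)"
      by (intro diff_chain_at)
    hence "((\<lambda>t. f (r, s, t)) has_derivative (\<lambda>w. c * w)) (at t)"
      by (simp add: o_def)
    thus ?thesis
      unfolding field_differentiable_def has_field_derivative_def
      using has_derivative_at_withinI by blast
  qed
  thus ?thesis by (simp add: holomorphic_on_def)
qed

theorem corollary2p4:
  fixes x :: real and \<Theta> :: "complex \<times> complex \<times> complex \<Rightarrow> complex"
    and r0 s0 t0 :: int
  assumes "x > 0"
    and "is_mordell_tornheim_zeta x \<Theta>"
    and "r0 < 0" "s0 < 0" "t0 < 0"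
    and "(odd r0 \<and> odd s0 \<and> odd t0) \<or>
         (odd r0 \<and> even s0 \<and> even t0) \<or>
         (even r0 \<and> odd s0 \<and> even t0) \<or>
         (even r0 \<and> even s0 \<and> odd t0)"
  shows "((\<lambda>t. \<Theta> (of_int r0, of_int s0, t)) \<longlongrightarrow> 0) (at (of_int t0))"
proof -
  define a b c where "a = nat (- r0)" and "b = nat (- s0)" and "c = nat (- t0)"
  have abc: "r0 = - int a" "s0 = - int b" "t0 = - int c" and ab: "a > 0" "b > 0"
    using assms(3-5) by (auto simp: a_def b_def c_def)
  have odd: "odd (a + b + c)" using assms(6) unfolding abc by auto
  define T where "T = 2 * real (a + b + 2)"
  define R where "R = T + 1"
  \<comment> \<open>All integers are removed, since these are the only possible singularities of
    \<open>G\<close> and \<open>H\<close> in the strip. \<open>S'\<close> is the part where the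
    double series represents \<open>G\<close>.\<close>
  define S where "S = {t. - real c - 1 < Re t \<and> Re t < R} - \<int>"
  define S' where "S' = {t. T < Re t \<and> Re t < R} - \<int>"
  define G where "G = (\<lambda>t. \<Theta> (of_int r0, of_int s0, t))"
  have "R > 2 * real (a + b + 2)" by (simp add: R_def T_def)
  from mellin_density_continuation[OF assms(1) ab odd this] obtain H where
    H: "H holomorphic_on S" "isCont H (- of_nat c)"
    and H_eq: "\<And>t. T < Re t \<Longrightarrow> Re t < R \<Longrightarrow>
      H t = (\<integral>u. exp (t * of_real (ln u)) * mellin_density a b x u \<partial>lborel)"
    unfolding S_def T_def by blast
  have strip: "open {t. p < Re t \<and> Re t < q}" "convex {t. p < Re t \<and> Re t < q}" for p q
    by (auto simp: Collect_conj_eq open_Int open_halfspace_Re_gt open_halfspace_Re_lt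
        convex_Int convex_halfspace_Re_gt convex_halfspace_Re_lt)
  have op: "open S" "open S'" unfolding S_def S'_def by (intro open_Diff strip closed_Ints)+
  \<comment> \<open>A convex open subset of the plane stays connected when a countable set is
    removed.\<close>
  have "countable (\<int> :: complex set)" by (simp add: Ints_def)
  hence conn: "connected S"
    unfolding S_def by (intro connected_open_diff_countable strip convex_connected) auto
  have hol3: "holomorphic3_on \<Theta> (- mordell_tornheim_singular)"
    using assms(2) by (simp add: is_mordell_tornheim_zeta_def meromorphic3_off_def)
  have G: "G holomorphic_on S"
    unfolding G_def
  proof (rule holomorphic3_on_imp_holomorphic_on[OF hol3])
    fix t assume "t \<in> S"
    hence t: "t \<notin> \<int>" by (simp add: S_def)
    \<comment> \<open>As \<open>r0\<close> and \<open>s0\<close> are integers, each singular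
      hyperplane would force \<open>t\<close> to be an integer.\<close>
    have *: "z \<in> \<int>" if "of_int i + z \<in> \<int>" for z :: complex and i
      using Ints_diff[OF that Ints_of_int[of i]] by simp
    show "(of_int r0, of_int s0, t) \<in> - mordell_tornheim_singular"
    proof
      assume "(of_int r0, of_int s0, t) \<in> mordell_tornheim_singular"
      then consider l :: nat where "of_int r0 + t = 1 - of_nat l" | l :: nat where "of_int s0 + t = 1 - of_nat l"
        | "of_int (r0 + s0) + t = 2" by (auto simp: mordell_tornheim_singular_def)
      thus False using t * by cases (metis Ints_1 Ints_diff Ints_of_nat Ints_numeral)+
    qed
  qed
  have GH: "G t = rGamma t * H t" if "t \<in> S" for t
  proof (rule analytic_continuation_open[OF op(2) op(1) _ conn _ G _ _ that])
    show "S' \<subseteq> S" by (auto simp: S_def S'_def T_def)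
    \<comment> \<open>The imaginary part 1 keeps this point away from the integers.\<close>
    have "Complex (T + 1/2) 1 \<in> S'" by (auto simp: S'_def R_def complex_is_Int_iff)
    thus "S' \<noteq> {}" by blast
    show "(\<lambda>t. rGamma t * H t) holomorphic_on S" by (intro holomorphic_intros H)
    fix t assume "t \<in> S'"
    hence t: "T < Re t" "Re t < R" "t \<notin> \<int>" by (auto simp: S'_def)
    have "t \<notin> \<int>\<^sub>\<le>\<^sub>0" using t(3) nonpos_Ints_Int by blast
    hence "Gamma t * rGamma t = 1" by (simp add: Gamma_eq_zero_iff rGamma_inverse_Gamma)
    have "(of_int r0, of_int s0, t) \<in> mordell_tornheim_region"
      using t by (auto simp: mordell_tornheim_region_def abc T_def)
    hence "G t = mordell_tornheim_series (of_int r0) (of_int s0) t x"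
      using assms(2) by (auto simp: is_mordell_tornheim_zeta_def G_def)
    also have "\<dots> = (Gamma t * rGamma t) * mordell_tornheim_series (- of_nat a) (- of_nat b) t x"
      using \<open>Gamma t * rGamma t = 1\<close> by (simp add: abc)
    also have "\<dots> = rGamma t * H t"
      using mellin_mordell_tornheim(2)[OF assms(1) ab, of t] t by (simp add: H_eq T_def)
    finally show "G t = rGamma t * H t" .
  qed
  have "((\<lambda>t. rGamma t * H t) \<longlongrightarrow> rGamma (- of_nat c) * H (- of_nat c)) (at (- of_nat c))"
    using H(2) isCont_rGamma[OF continuous_ident] unfolding isCont_def by (intro tendsto_mult)
  \<comment> \<open>The point \<open>t0\<close> itself gives a triple on the singular set, where the
    values of \<open>\<Theta>\<close> are arbitrary. Only a punctured neighbourhood enters, and the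
    remaining integers form a closed set avoiding \<open>- c\<close>.\<close>
  moreover have "eventually (\<lambda>t. rGamma t * H t = G t) (at (- of_nat c))"
  proof -
    have "eventually (\<lambda>t. t \<in> {t. - real c - 1 < Re t \<and> Re t < R}) (at (- of_nat c))"
      by (rule eventually_at_in_open'[OF strip(1)]) (auto simp: R_def T_def)
    moreover have "eventually (\<lambda>t. t \<notin> \<int>) (at (- of_nat c :: complex))"
    proof -
      have "eventually (\<lambda>t. t \<in> - (\<int> - {- of_nat c})) (at (- of_nat c :: complex))"
        by (rule eventually_at_in_open'[OF open_Compl[OF closed_subset_Ints]]) auto
      moreover have "eventually (\<lambda>t. t \<noteq> - of_nat c) (at (- of_nat c :: complex))"
        by (rule eventually_neq_at_within)
      ultimately show ?thesis by eventually_elim auto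
    qed
    ultimately show ?thesis by eventually_elim (auto simp: GH S_def)
  qed
  ultimately have "(G \<longlongrightarrow> rGamma (- of_nat c) * H (- of_nat c)) (at (- of_nat c))"
    by (rule Lim_transform_eventually)
  \<comment> \<open>\<open>rGamma\<close> vanishes at the nonpositive integer \<open>- c\<close>,
    while \<open>H (- c)\<close> is an ordinary finite value.\<close>
  thus ?thesis by (simp add: G_def abc rGamma_eq_zero_iff)
qed

end
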